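(* Let $f\in\mathcal{K}$ have radius of convergence $R\le\infty$ and associated family $(X_t)_{t\in[0,R)}$. If $f$ is a clan, then $$\lim_{t\uparrow R}\frac{\mathbf{E}(X_t^p)}{\mathbf{E}(X_t)^p}=1,\qquad\text{for every } p>0.$$
   Context: $\mathcal{K}$ is the class of nonconstant power series $f(z)=\sum_{n=0}^\infty a_nz^n$ with positive radius of convergence $R\le\infty$, with all $a_n\ge 0$ and with $a_0>0$. The associated (Khinchin) family $(X_t)_{t\in[0,R)}$ consists of random variables with values in $\{0,1,2,\dots\}$, with $X_0\equiv 0$ and $\mathbf{P}(X_t=n)=a_nt^n/f(t)$ for $t\in(0,R)$, $n\ge 0$. $\mathbf{E}$ and $\mathbf{V}$ denote expectation and variance. Write $m_f(t)=\mathbf{E}(X_t)$ and $\sigma_f^2(t)=\mathbf{V}(X_t)$, with $\sigma_f(t)\ge 0$. The power series $f$ is called a clan if $\lim_{t\uparrow R}\sigma_f(t)/m_f(t)=0$. When $R=\infty$, $t\uparrow R$ means $t\to\infty$. *)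

theory Defs
  imports "HOL-Probability.Probability" "HOL-Analysis.FPS_Convergence"
begin

definition class_K :: "real fps set" where
  "class_K = {f. (\<exists>n>0. fps_nth f n \<noteq> 0) \<and> fps_conv_radius f > 0 \<and>
                 (\<forall>n. fps_nth f n \<ge> 0) \<and> fps_nth f 0 > 0}"

text \<open>
  The law of \<open>X\<^sub>t\<close>. The random variable itself is the identity on the
  probability space \<open>khinchin_pmf f t\<close> over the natural numbers. The mass function is
  legitimate for \<open>f \<in> class_K\<close> and \<open>0 \<le> t < R\<close> (lemma \<open>pmf_khinchin_pmf\<close>); as \<open>0 ^ 0 = 1\<close>,
  it also covers \<open>X\<^sub>0 = 0\<close> (lemma \<open>khinchin_pmf_0\<close>).
\<close>

definition khinchin_pmf :: "real fps \<Rightarrow> real \<Rightarrow> nat pmf" where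
  "khinchin_pmf f t = embed_pmf (\<lambda>n. fps_nth f n * t ^ n / eval_fps f t)"

definition khinchin_mean :: "real fps \<Rightarrow> real \<Rightarrow> real" where
  "khinchin_mean f t = measure_pmf.expectation (khinchin_pmf f t) (\<lambda>n. real n)"

definition khinchin_sd :: "real fps \<Rightarrow> real \<Rightarrow> real" where
  "khinchin_sd f t = sqrt (measure_pmf.variance (khinchin_pmf f t) (\<lambda>n. real n))"

text \<open>The filter of real \<open>t\<close> approaching the extended real \<open>R > 0\<close> from below.\<close>

definition at_up :: "ereal \<Rightarrow> real filter" where
  "at_up R = (if R = \<infinity> then at_top else at_left (real_of_ereal R))"

definition clan :: "real fps \<Rightarrow> bool" where
  "clan f \<longleftrightarrow>
     ((\<lambda>t. khinchin_sd f t / khinchin_mean f t) \<longlongrightarrow> 0) (at_up (fps_conv_radius f))"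

lemma pmf_khinchin_pmf:
  assumes f: "f \<in> class_K" and t: "0 \<le> t" "ereal t < fps_conv_radius f"
  shows "pmf (khinchin_pmf f t) n = fps_nth f n * t ^ n / eval_fps f t"
proof -
  have nn: "fps_nth f n * t ^ n \<ge> 0" for n
    using f t by (auto simp: class_K_def)
  have sm: "summable (\<lambda>n. fps_nth f n * t ^ n)"
    using t by (intro summable_fps) auto
  have "0 < fps_nth f 0 * t ^ 0"
    using f by (simp add: class_K_def)
  then have pos: "eval_fps f t > 0"
    unfolding eval_fps_def using suminf_pos2[OF sm nn] by blast
  have "(\<lambda>n. fps_nth f n * t ^ n / eval_fps f t) sums 1"
    using sums_divide[OF summable_sums[OF sm], of "eval_fps f t"] pos
    by (simp add: eval_fps_def)
  then have "(\<Sum>n. ennreal (fps_nth f n * t ^ n / eval_fps f t)) = 1"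
    using nn pos by (subst suminf_ennreal2) (auto simp: sums_iff)
  then have "(\<integral>\<^sup>+n. ennreal (fps_nth f n * t ^ n / eval_fps f t) \<partial>count_space UNIV) = 1"
    by (simp add: nn_integral_count_space_nat)
  then show ?thesis
    unfolding khinchin_pmf_def using nn pos by (intro pmf_embed_pmf) auto
qed

lemma khinchin_pmf_0:
  assumes "f \<in> class_K"
  shows "khinchin_pmf f 0 = return_pmf 0"
proof (rule pmf_eqI)
  fix n
  have "ereal 0 < fps_conv_radius f" "fps_nth f 0 > 0"
    using assms by (auto simp: class_K_def zero_ereal_def)
  then show "pmf (khinchin_pmf f 0) n = pmf (return_pmf 0) n"
    using assms by (subst pmf_khinchin_pmf) (auto simp: eval_fps_at_0 power_0_left indicator_def)
qed

end

theory Submission imports Defs begin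

text \<open>
  Put \<open>s = ln t\<close>. In this variable \<open>(ln f)' = m\<close> and \<open>(1 / m)' = - (\<sigma> / m)\<^sup>2\<close>, so for a clan \<open>1 / m\<close>
  varies slowly: \<open>m\<close> at most doubles on \<open>[s, s + 2 / m(s)]\<close>. Hence
  \<open>E (exp (2 X\<^sub>t / m)) = f (t exp (2 / m)) / f t\<close> stays bounded as \<open>t\<close> tends to \<open>R\<close>.
  With \<open>Y = X\<^sub>t / m\<close>, the bound \<open>\<bar>Y powr p - 1\<bar> \<le> C \<bar>Y - 1\<bar> exp Y\<close> and the arithmetic-geometric mean
  inequality give, for every \<open>\<delta> > 0\<close>,
  \<open>E \<bar>Y powr p - 1\<bar> \<le> C (\<delta> E (exp (2 Y)) + E ((Y - 1)\<^sup>2) / \<delta>)\<close>, where \<open>E ((Y - 1)\<^sup>2) = (\<sigma> / m)\<^sup>2\<close>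
  tends to \<open>0\<close>.
  If \<open>R\<close> is finite, \<open>t exp (2 / m) < R\<close> has to be shown as well. It holds because \<open>f\<close> is unbounded,
  which follows from \<open>(\<sigma> / m)\<^sup>2 \<ge> P (X\<^sub>t = 0) = a\<^sub>0 / f t\<close>.
\<close>

section \<open>The filter \<open>at_up\<close> and differentiation in the variable
  \<open>ln t\<close>\<close>

text \<open>Gives finite and infinite \<open>R\<close> one common form. Positivity of
  \<open>R\<close> leaves room to take \<open>t0\<close> positive, so that \<open>ln t\<close> makes
  sense beyond it.\<close>

lemma eventually_at_up:
  assumes "R > 0"
  shows "eventually P (at_up R) \<longleftrightarrow>
    (\<exists>t0>0. ereal t0 < R \<and> (\<forall>t. t0 < t \<and> ereal t < R \<longrightarrow> P t))"
proof (cases R)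
  case (real r)
  then have "r > 0" using assms by simp
  have "(\<exists>b<r. \<forall>y>b. y < r \<longrightarrow> P y) \<longleftrightarrow> (\<exists>t0>0. t0 < r \<and> (\<forall>t. t0 < t \<and> t < r \<longrightarrow> P t))"
    (is "?A \<longleftrightarrow> ?B")
  proof
    assume ?A
    then obtain b where b: "b < r" "\<forall>y>b. y < r \<longrightarrow> P y" by blast
    then show ?B using \<open>r > 0\<close> by (intro exI[of _ "max b (r/2)"]) auto
  qed blast
  then show ?thesis
    using real by (simp add: at_up_def eventually_at_left_field)
next
  case PInf
  have "(\<exists>b. \<forall>y>b. P y) \<longleftrightarrow> (\<exists>t0>0. \<forall>t>t0. P t)" (is "?A \<longleftrightarrow> ?B")
  proof
    assume ?A
    then obtain b where b: "\<forall>y>b. P y" by blast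
    then show ?B by (intro exI[of _ "max b 1"]) auto
  qed blast
  then show ?thesis
    using PInf by (simp add: at_up_def eventually_at_top_dense)
qed (use assms in simp)

lemma fps_conv_radius_XD:
  fixes f :: "real fps"
  shows "fps_conv_radius f \<le> fps_conv_radius (fps_XD f)"
proof -
  have "fps_conv_radius f \<le> min (fps_conv_radius (fps_X :: real fps)) (fps_conv_radius (fps_deriv f))"
    using fps_conv_radius_deriv[of f] by simp
  also have "\<dots> \<le> fps_conv_radius (fps_XD f)"
    unfolding fps_XD_def o_def by (rule fps_conv_radius_mult)
  finally show ?thesis .
qed

lemma eval_fps_XD:
  fixes f :: "real fps"
  assumes "ereal \<bar>t\<bar> < fps_conv_radius f"
  shows "eval_fps (fps_XD f) t = t * eval_fps (fps_deriv f) t"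
  unfolding fps_XD_def o_def
  using assms fps_conv_radius_deriv[of f] by (subst eval_fps_mult) auto

text \<open>The chain rule turns \<open>t * d/dt\<close> into \<open>d/ds\<close> under
  \<open>t = exp s\<close>. Applied again to \<open>fps_XD f\<close>, this supplies the derivative
  of the mean.\<close>

lemma DERIV_eval_fps_exp:
  fixes f :: "real fps"
  assumes "ereal (exp s) < fps_conv_radius f"
  shows "((\<lambda>s. eval_fps f (exp s)) has_real_derivative eval_fps (fps_XD f) (exp s)) (at s)"
proof -
  have "((\<lambda>s. eval_fps f (exp s)) has_real_derivative eval_fps (fps_deriv f) (exp s) * exp s) (at s)"
    using assms by (intro DERIV_chain2[OF has_field_derivative_eval_fps] DERIV_exp) auto
  then show ?thesis
    using assms by (simp add: eval_fps_XD mult.commute)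
qed

section \<open>Elementary inequalities for powers\<close>

text \<open>For \<open>i < k\<close> the factor \<open>fact k / fact i\<close> is at least
  \<open>1\<close>, so the sum is dominated termwise by \<open>fact k\<close> times a partial sum of
  the exponential series.\<close>

lemma power_sum_le_exp:
  fixes y :: real
  assumes "y \<ge> 0"
  shows "(\<Sum>i<k. y ^ i) \<le> fact k * exp y"
proof -
  have "(\<Sum>i<k. y ^ i) \<le> (\<Sum>i<k. fact k * (inverse (fact i) * y ^ i))"
  proof (rule sum_mono)
    fix i assume "i \<in> {..<k}"
    then have "(fact i :: real) \<le> fact k" by (intro fact_mono) auto
    then have "1 \<le> fact k * inverse (fact i :: real)" by (simp add: field_simps)
    then have "1 * y ^ i \<le> (fact k * inverse (fact i)) * y ^ i"
      using assms by (intro mult_right_mono) auto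
    then show "y ^ i \<le> fact k * (inverse (fact i) * y ^ i)" by (simp add: mult.assoc)
  qed
  also have "\<dots> = fact k * (\<Sum>i<k. inverse (fact i) * y ^ i)"
    by (simp add: sum_distrib_left)
  also have "(\<Sum>i<k. inverse (fact i) * y ^ i) \<le> (\<Sum>i. inverse (fact i) * y ^ i)"
    using assms by (intro sum_le_suminf summable_exp) auto
  also have "\<dots> = exp y"
    by (simp add: exp_def scaleR_conv_of_real)
  finally show ?thesis by simp
qed

text \<open>Raising the exponent from \<open>p\<close> to \<open>k\<close> moves the power away from
  \<open>1\<close> on either side of \<open>y = 1\<close>, which reduces the claim to
  \<open>y ^ k - 1 = (y - 1) * (\<Sum>i<k. y ^ i)\<close>. The weight \<open>\<delta>\<close> stays
  free: the exponential term will only be bounded in mean, while the quadratic one tends to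
  \<open>0\<close>.\<close>

lemma abs_powr_minus_one_le:
  fixes y p \<delta> :: real
  assumes y: "y \<ge> 0" and p: "0 < p" "p \<le> real k" and \<delta>: "\<delta> > 0"
  shows "\<bar>y powr p - 1\<bar> \<le> fact k * (\<delta> * exp (2 * y) + (y - 1)\<^sup>2 / \<delta>)"
proof -
  \<comment> \<open>At \<open>y = 0\<close> the two kinds of power agree only for positive
    \<open>k\<close>: \<open>0 powr 0\<close> is \<open>0\<close>, but \<open>0 ^ 0\<close> is
    \<open>1\<close>.\<close>
  have "k > 0" using p by (cases k) auto
  have k: "y powr real k = y ^ k"
    using y \<open>k > 0\<close> by (cases "y = 0") (auto simp: powr_realpow)
  have "\<bar>y powr p - 1\<bar> \<le> \<bar>y ^ k - 1\<bar>"
  proof (cases "y \<le> 1")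
    case True
    then have "y powr p \<le> 1" "y powr real k \<le> y powr p"
      using y p by (auto intro: powr_le1 powr_mono')
    then show ?thesis using k by auto
  next
    case False
    then have "1 \<le> y powr p" "y powr p \<le> y powr real k"
      using p by (auto intro: ge_one_powr_ge_zero powr_mono)
    then show ?thesis using k by auto
  qed
  also have "\<dots> = \<bar>y - 1\<bar> * (\<Sum>i<k. y ^ i)"
    using y by (simp add: power_diff_1_eq abs_mult sum_nonneg)
  also have "\<dots> \<le> \<bar>y - 1\<bar> * (fact k * exp y)"
    by (intro mult_left_mono power_sum_le_exp y) auto
  also have "\<dots> = fact k * (\<bar>y - 1\<bar> * exp y)" by simp
  also have "\<bar>y - 1\<bar> * exp y \<le> \<delta> * exp (2 * y) + (y - 1)\<^sup>2 / \<delta>"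
  proof -
    define a where "a = exp y"
    define b where "b = \<bar>y - 1\<bar>"
    have ab: "a \<ge> 0" "b \<ge> 0" by (auto simp: a_def b_def)
    \<comment> \<open>The square contributes the cross term \<open>- 2 * \<delta> * a * b\<close>;
      adding \<open>\<delta> * a * b\<close> leaves exactly one copy of it to move across.\<close>
    have "0 \<le> (\<delta> * a - b)\<^sup>2 + \<delta> * a * b" using ab \<delta> by simp
    then have "b * a * \<delta> \<le> (\<delta> * a)\<^sup>2 + b\<^sup>2"
      by (simp add: power2_eq_square algebra_simps)
    then have "b * a \<le> \<delta> * a\<^sup>2 + b\<^sup>2 / \<delta>"
      using \<delta> by (simp add: field_simps power2_eq_square)
    then show ?thesis
      by (simp add: a_def b_def exp_double)
  qed
  finally show ?thesis by simp
qed

section \<open>Moments of the family as values of power series\<close>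

context
  fixes f :: "real fps"
  assumes f: "f \<in> class_K"
begin

lemma class_K_nth_nonneg: "fps_nth f n \<ge> 0"
  using f by (simp add: class_K_def)

lemma class_K_nth_0_pos: "fps_nth f 0 > 0"
  using f by (simp add: class_K_def)

lemma class_K_conv_radius_pos: "fps_conv_radius f > 0"
  using f by (simp add: class_K_def)

lemma eval_class_K_pos:
  assumes "0 \<le> t" "ereal t < fps_conv_radius f"
  shows "eval_fps f t > 0"
proof -
  have "summable (\<lambda>n. fps_nth f n * t ^ n)"
    using assms by (intro summable_fps) auto
  moreover have "0 < fps_nth f 0 * t ^ 0"
    using class_K_nth_0_pos by simp
  ultimately show ?thesis
    unfolding eval_fps_def using class_K_nth_nonneg assms by (intro suminf_pos2[of _ 0]) auto
qed

lemma eval_XD_class_K_pos: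
  assumes "0 < t" "ereal t < fps_conv_radius f"
  shows "eval_fps (fps_XD f) t > 0"
proof -
  obtain n where n: "n > 0" "fps_nth f n \<noteq> 0" using f by (auto simp: class_K_def)
  have "ereal \<bar>t\<bar> < fps_conv_radius (fps_XD f)"
    using assms fps_conv_radius_XD[of f] by (auto intro: less_le_trans)
  then have "summable (\<lambda>n. fps_nth (fps_XD f) n * t ^ n)"
    by (intro summable_fps) auto
  moreover have "0 < fps_nth (fps_XD f) n * t ^ n"
    using n class_K_nth_nonneg[of n] assms by simp
  moreover have "0 \<le> fps_nth (fps_XD f) n * t ^ n" for n
    using class_K_nth_nonneg[of n] assms by simp
  ultimately show ?thesis
    unfolding eval_fps_def by (intro suminf_pos2) auto
qed

text \<open>As \<open>h\<close> and the masses are nonnegative, convergence of the series is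
  absolute, so one \<open>sums\<close> fact yields both integrability and the value.\<close>

lemma khinchin_expectation:
  assumes t: "0 \<le> t" "ereal t < fps_conv_radius f" and h: "\<And>n. h n \<ge> 0"
    and S: "(\<lambda>n. h n * (fps_nth f n * t ^ n)) sums S"
  shows "integrable (measure_pmf (khinchin_pmf f t)) h"
    and "measure_pmf.expectation (khinchin_pmf f t) h = S / eval_fps f t"
proof -
  let ?p = "pmf (khinchin_pmf f t)"
  have sums: "(\<lambda>n. ?p n * h n) sums (S / eval_fps f t)"
    using sums_divide[OF S, of "eval_fps f t"]
    by (simp add: pmf_khinchin_pmf[OF f t] mult_ac)
  then have int: "integrable (count_space UNIV) (\<lambda>n. ?p n * h n)"
    using h by (auto simp: integrable_count_space_nat_iff abs_mult sums_iff)
  then show "integrable (measure_pmf (khinchin_pmf f t)) h"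
    by (simp add: measure_pmf_eq_density integrable_real_density)
  show "measure_pmf.expectation (khinchin_pmf f t) h = S / eval_fps f t"
    using sums integral_count_space_nat[OF int]
    by (simp add: measure_pmf_eq_density integral_real_density sums_iff)
qed

lemma khinchin_mean_eq:
  assumes t: "0 \<le> t" "ereal t < fps_conv_radius f"
  shows "integrable (measure_pmf (khinchin_pmf f t)) real"
    and "khinchin_mean f t = eval_fps (fps_XD f) t / eval_fps f t"
proof -
  have "ereal \<bar>t\<bar> < fps_conv_radius (fps_XD f)"
    using t fps_conv_radius_XD[of f] by (auto intro: less_le_trans)
  then have S: "(\<lambda>n. real n * (fps_nth f n * t ^ n)) sums eval_fps (fps_XD f) t"
    using sums_eval_fps[of t "fps_XD f"] by (simp add: mult.assoc)
  show "integrable (measure_pmf (khinchin_pmf f t)) real"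
    and "khinchin_mean f t = eval_fps (fps_XD f) t / eval_fps f t"
    unfolding khinchin_mean_def using khinchin_expectation[OF t _ S] by auto
qed

lemma khinchin_second_moment:
  assumes t: "0 \<le> t" "ereal t < fps_conv_radius f"
  shows "integrable (measure_pmf (khinchin_pmf f t)) (\<lambda>n. (real n)\<^sup>2)"
    and "measure_pmf.expectation (khinchin_pmf f t) (\<lambda>n. (real n)\<^sup>2) =
      eval_fps (fps_XD (fps_XD f)) t / eval_fps f t"
proof -
  have "ereal \<bar>t\<bar> < fps_conv_radius (fps_XD (fps_XD f))"
    using t fps_conv_radius_XD[of f] fps_conv_radius_XD[of "fps_XD f"]
    by (auto intro: less_le_trans)
  then have S: "(\<lambda>n. (real n)\<^sup>2 * (fps_nth f n * t ^ n)) sums eval_fps (fps_XD (fps_XD f)) t"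
    using sums_eval_fps[of t "fps_XD (fps_XD f)"] by (simp add: mult.assoc power2_eq_square)
  show "integrable (measure_pmf (khinchin_pmf f t)) (\<lambda>n. (real n)\<^sup>2)"
    and "measure_pmf.expectation (khinchin_pmf f t) (\<lambda>n. (real n)\<^sup>2) =
      eval_fps (fps_XD (fps_XD f)) t / eval_fps f t"
    using khinchin_expectation[OF t _ S] by auto
qed

text \<open>The weight \<open>exp (c * n)\<close> is absorbed into \<open>t ^ n\<close>, giving
  \<open>(t * exp c) ^ n\<close>.\<close>

lemma khinchin_exp_moment:
  assumes t: "0 \<le> t" "ereal t < fps_conv_radius f" "ereal (t * exp c) < fps_conv_radius f"
  shows "integrable (measure_pmf (khinchin_pmf f t)) (\<lambda>n. exp (c * real n))"
    and "measure_pmf.expectation (khinchin_pmf f t) (\<lambda>n. exp (c * real n)) =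
      eval_fps f (t * exp c) / eval_fps f t"
proof -
  have "norm (t * exp c) < fps_conv_radius f" using t by (simp add: abs_mult)
  from sums_eval_fps[OF this]
  have S: "(\<lambda>n. exp (c * real n) * (fps_nth f n * t ^ n)) sums eval_fps f (t * exp c)"
    by (simp add: power_mult_distrib mult_ac flip: exp_of_nat_mult)
  show "integrable (measure_pmf (khinchin_pmf f t)) (\<lambda>n. exp (c * real n))"
    and "measure_pmf.expectation (khinchin_pmf f t) (\<lambda>n. exp (c * real n)) =
      eval_fps f (t * exp c) / eval_fps f t"
    using khinchin_expectation[OF t(1,2) _ S] by auto
qed

lemma khinchin_mean_pos:
  assumes t: "0 < t" "ereal t < fps_conv_radius f"
  shows "khinchin_mean f t > 0"
  using khinchin_mean_eq(2)[of t] eval_class_K_pos[of t] eval_XD_class_K_pos[of t] t by simp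

lemma khinchin_sd_square:
  "(khinchin_sd f t)\<^sup>2 = measure_pmf.expectation (khinchin_pmf f t) (\<lambda>n. (real n - khinchin_mean f t)\<^sup>2)"
  unfolding khinchin_sd_def khinchin_mean_def by (simp add: measure_pmf.variance_positive)

lemma khinchin_sd_square_eq:
  assumes t: "0 \<le> t" "ereal t < fps_conv_radius f"
  shows "(khinchin_sd f t)\<^sup>2 =
    eval_fps (fps_XD (fps_XD f)) t / eval_fps f t - (khinchin_mean f t)\<^sup>2"
proof -
  have "(khinchin_sd f t)\<^sup>2 = measure_pmf.variance (khinchin_pmf f t) real"
    unfolding khinchin_sd_def by (simp add: measure_pmf.variance_positive)
  also have "\<dots> = eval_fps (fps_XD (fps_XD f)) t / eval_fps f t - (khinchin_mean f t)\<^sup>2"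
    using khinchin_mean_eq(1)[OF t] khinchin_second_moment[OF t]
    by (subst measure_pmf.variance_eq) (auto simp: khinchin_mean_def)
  finally show ?thesis .
qed

lemma integrable_khinchin_deviation:
  assumes t: "0 \<le> t" "ereal t < fps_conv_radius f"
  shows "integrable (measure_pmf (khinchin_pmf f t)) (\<lambda>n. (real n - c)\<^sup>2)"
proof -
  have "(\<lambda>n. (real n - c)\<^sup>2) = (\<lambda>n. (real n)\<^sup>2 - 2 * c * real n + c\<^sup>2)"
    by (auto simp: power2_eq_square algebra_simps)
  then show ?thesis
    using khinchin_mean_eq(1)[OF t] khinchin_second_moment(1)[OF t] by simp
qed

text \<open>The variance is at least the contribution of the atom at \<open>0\<close>, where the
  squared deviation is \<open>m\<^sup>2\<close> and the mass is
  \<open>a\<^sub>0 / f t\<close>.\<close>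

lemma nth_0_le_khinchin_dispersion:
  assumes t: "0 < t" "ereal t < fps_conv_radius f"
  shows "fps_nth f 0 / eval_fps f t \<le> (khinchin_sd f t / khinchin_mean f t)\<^sup>2"
proof -
  let ?m = "khinchin_mean f t" and ?P = "measure_pmf (khinchin_pmf f t)"
  have "?m\<^sup>2 * (fps_nth f 0 / eval_fps f t) = (\<integral>n. ?m\<^sup>2 * indicator {0} n \<partial>?P)"
    using pmf_khinchin_pmf[OF f _ t(2), of 0] t by (simp add: pmf.rep_eq)
  also have "\<dots> \<le> (\<integral>n. (real n - ?m)\<^sup>2 \<partial>?P)"
  proof (rule integral_mono)
    show "integrable ?P (\<lambda>n. ?m\<^sup>2 * indicator {0} n)"
      by (intro integrable_mult_right measure_pmf.integrable_const_bound[where B = 1])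
         (auto simp: indicator_def)
    show "integrable ?P (\<lambda>n. (real n - ?m)\<^sup>2)"
      using t by (intro integrable_khinchin_deviation) auto
  qed (auto simp: indicator_def)
  also have "\<dots> = (khinchin_sd f t)\<^sup>2" by (simp add: khinchin_sd_square)
  finally show ?thesis
    using khinchin_mean_pos[OF t] by (simp add: power_divide field_simps)
qed

section \<open>Growth of \<open>ln f\<close> and of \<open>1 / m\<close> in the variable
  \<open>s = ln t\<close>\<close>

lemma DERIV_ln_class_K:
  assumes s: "ereal (exp s) < fps_conv_radius f"
  shows "((\<lambda>s. ln (eval_fps f (exp s))) has_real_derivative khinchin_mean f (exp s)) (at s)"
  using DERIV_eval_fps_exp[OF s] eval_class_K_pos[OF _ s] khinchin_mean_eq(2)[OF _ s]
  by (auto intro!: derivative_eq_intros)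

text \<open>The quotient is \<open>1 / m\<close>, written so that the quotient rule applies to power
  series. Its derivative \<open>1 - F * F2 / F1\<^sup>2\<close> is
  \<open>1 - E (X\<^sup>2) / m\<^sup>2\<close>.\<close>

lemma DERIV_inverse_mean:
  assumes s: "ereal (exp s) < fps_conv_radius f"
  shows "((\<lambda>s. eval_fps f (exp s) / eval_fps (fps_XD f) (exp s)) has_real_derivative
    - (khinchin_sd f (exp s) / khinchin_mean f (exp s))\<^sup>2) (at s)"
proof -
  let ?F = "eval_fps f (exp s)" and ?F1 = "eval_fps (fps_XD f) (exp s)"
    and ?F2 = "eval_fps (fps_XD (fps_XD f)) (exp s)"
  have s1: "ereal (exp s) < fps_conv_radius (fps_XD f)"
    using s fps_conv_radius_XD[of f] by (auto intro: less_le_trans)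
  have pos: "?F > 0" "?F1 > 0"
    using s eval_class_K_pos eval_XD_class_K_pos by auto
  have "(?F1 * ?F1 - ?F * ?F2) / (?F1 * ?F1) = - (khinchin_sd f (exp s) / khinchin_mean f (exp s))\<^sup>2"
  proof -
    have q: "(khinchin_sd f (exp s))\<^sup>2 = ?F2 / ?F - (khinchin_mean f (exp s))\<^sup>2"
      and m: "khinchin_mean f (exp s) = ?F1 / ?F"
      using s by (auto intro: khinchin_sd_square_eq khinchin_mean_eq(2))
    show ?thesis
      unfolding power_divide q m using pos by (simp add: power2_eq_square field_simps)
  qed
  then show ?thesis
    using DERIV_divide[OF DERIV_eval_fps_exp[OF s] DERIV_eval_fps_exp[OF s1]] pos by simp
qed

text \<open>Mean value theorem for \<open>1 / m\<close>, whose slope is at least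
  \<open>- \<epsilon>\<close> to the right of \<open>s\<close>. Thus \<open>m\<close> cannot grow
  quickly there.\<close>

lemma inverse_mean_lower_bound:
  assumes s: "s < s'" "ereal (exp s') < fps_conv_radius f"
    and \<epsilon>: "\<And>u. s < u \<Longrightarrow> ereal (exp u) < fps_conv_radius f \<Longrightarrow>
      (khinchin_sd f (exp u) / khinchin_mean f (exp u))\<^sup>2 \<le> \<epsilon>"
  shows "1 / khinchin_mean f (exp s) \<le> 1 / khinchin_mean f (exp s') + \<epsilon> * (s' - s)"
proof -
  let ?G = "\<lambda>s. eval_fps f (exp s) / eval_fps (fps_XD f) (exp s)"
  have R: "ereal (exp u) < fps_conv_radius f" if "u \<le> s'" for u
    using that s(2) by (intro le_less_trans[OF _ s(2)]) auto
  obtain z where z: "s < z" "z < s'"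
    and eq: "?G s' - ?G s = (s' - s) * - (khinchin_sd f (exp z) / khinchin_mean f (exp z))\<^sup>2"
    using MVT2[OF s(1), of ?G "\<lambda>s. - (khinchin_sd f (exp s) / khinchin_mean f (exp s))\<^sup>2"]
      DERIV_inverse_mean R by auto
  have "(s' - s) * (khinchin_sd f (exp z) / khinchin_mean f (exp z))\<^sup>2 \<le> (s' - s) * \<epsilon>"
    using z \<epsilon> R s by (intro mult_left_mono) auto
  then have "?G s \<le> ?G s' + \<epsilon> * (s' - s)"
    using eq by (simp only: mult_minus_right mult.commute[of \<epsilon>])
  moreover have "1 / khinchin_mean f (exp u) = ?G u" if "u \<le> s'" for u
    using R[OF that] by (simp add: khinchin_mean_eq(2))
  ultimately show ?thesis using s(1) by simp
qed

text \<open>Serves in both directions: a large rise of \<open>ln f\<close> forces a large mean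
  somewhere, and a bound on the mean limits the rise.\<close>

lemma ln_class_K_MVT:
  assumes s: "s < s'" "ereal (exp s') < fps_conv_radius f"
  obtains z where "s < z" "z < s'" "ereal (exp z) < fps_conv_radius f"
    "ln (eval_fps f (exp s')) - ln (eval_fps f (exp s)) = (s' - s) * khinchin_mean f (exp z)"
proof -
  have R: "ereal (exp u) < fps_conv_radius f" if "u \<le> s'" for u
    using that s(2) by (intro le_less_trans[OF _ s(2)]) auto
  then obtain z where "s < z" "z < s'"
    "ln (eval_fps f (exp s')) - ln (eval_fps f (exp s)) = (s' - s) * khinchin_mean f (exp z)"
    using MVT2[OF s(1), of "\<lambda>s. ln (eval_fps f (exp s))" "\<lambda>s. khinchin_mean f (exp s)"]
      DERIV_ln_class_K by auto
  then show ?thesis using R that by auto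
qed

section \<open>Consequences of the clan property\<close>

text \<open>The dispersion tends to \<open>0\<close> but is at least \<open>a\<^sub>0 / f t\<close>,
  so \<open>f t\<close> must become large near \<open>R\<close>.\<close>

lemma clan_unbounded:
  assumes "clan f" and t: "ereal t < fps_conv_radius f"
  obtains t' where "t < t'" "ereal t' < fps_conv_radius f" "B < eval_fps f t'"
proof -
  let ?q = "\<lambda>t. khinchin_sd f t / khinchin_mean f t"
  \<comment> \<open>The maximum keeps the divisor positive. A dispersion below
    \<open>\<delta>\<^sup>2 = a\<^sub>0 / C\<close> then means \<open>f t' > C\<close>.\<close>
  define C where "C = max B 1"
  define \<delta> where "\<delta> = sqrt (fps_nth f 0 / C)"
  have C: "C > 0" "B \<le> C" by (auto simp: C_def)
  have \<delta>: "\<delta> > 0" "\<delta>\<^sup>2 = fps_nth f 0 / C"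
    using C class_K_nth_0_pos by (auto simp: \<delta>_def)
  have "eventually (\<lambda>t. dist (?q t) 0 < \<delta>) (at_up (fps_conv_radius f))"
    using assms(1) \<delta>(1) unfolding clan_def by (rule tendstoD)
  then obtain t0 where t0: "t0 > 0" "ereal t0 < fps_conv_radius f"
    "\<And>t. t0 < t \<Longrightarrow> ereal t < fps_conv_radius f \<Longrightarrow> \<bar>?q t\<bar> < \<delta>"
    unfolding eventually_at_up[OF class_K_conv_radius_pos] by auto
  have "ereal (max t t0) < fps_conv_radius f" using t t0(2) by (simp add: max_def)
  then obtain t' where "max t t0 < t'" "ereal t' < fps_conv_radius f"
    using ereal_dense2 by (metis less_ereal.simps(1))
  then have t': "t < t'" "t0 < t'" "0 < t'" "ereal t' < fps_conv_radius f" using t0(1) by auto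
  have "(?q t')\<^sup>2 < \<delta>\<^sup>2"
    using t0(3)[of t'] t' by (intro abs_le_square_iff[THEN iffD1] power2_strict_mono) auto
  then have "fps_nth f 0 / eval_fps f t' < fps_nth f 0 / C"
    using nth_0_le_khinchin_dispersion[of t'] t' \<delta>(2) by simp
  then have "C < eval_fps f t'"
    using C eval_class_K_pos[of t'] t' class_K_nth_0_pos by (simp add: field_simps)
  then show ?thesis using that t' C by auto
qed

text \<open>Once \<open>\<sigma> / m < 1/2\<close>, the slope of \<open>1 / m\<close> is at least
  \<open>- 1/4\<close>. Over a shift of \<open>2 / m\<close> at most half of \<open>1 / m\<close> is
  lost, so the mean at most doubles and \<open>ln f\<close> rises by at most
  \<open>(2 / m) * (2 * m) = 4\<close>.\<close>

lemma clan_exp_shift: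
  assumes clan: "clan f"
  shows "eventually (\<lambda>t. ereal (t * exp (2 / khinchin_mean f t)) < fps_conv_radius f \<and>
    eval_fps f (t * exp (2 / khinchin_mean f t)) / eval_fps f t \<le> exp 4) (at_up (fps_conv_radius f))"
proof -
  let ?R = "fps_conv_radius f"
  let ?q = "\<lambda>t. khinchin_sd f t / khinchin_mean f t"
  have "eventually (\<lambda>t. dist (?q t) 0 < 1/2) (at_up ?R)"
    using clan unfolding clan_def by (rule tendstoD) simp
  then obtain t0 where t0: "t0 > 0" "ereal t0 < ?R"
    "\<And>t. t0 < t \<Longrightarrow> ereal t < ?R \<Longrightarrow> \<bar>?q t\<bar> < 1/2"
    unfolding eventually_at_up[OF class_K_conv_radius_pos] by auto
  have q: "(?q t)\<^sup>2 \<le> 1/4" if "t0 < t" "ereal t < ?R" for t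
    using power_mono[of "\<bar>?q t\<bar>" "1/2" 2] t0(3)[OF that] by (simp add: power2_eq_square)
  show ?thesis
    unfolding eventually_at_up[OF class_K_conv_radius_pos]
  proof (intro exI[of _ t0] conjI allI impI)
    fix t assume "t0 < t \<and> ereal t < ?R"
    then have t: "t0 < t" "0 < t" "ereal t < ?R" using t0(1) by auto
    define s where "s = ln t"
    have s: "exp s = t" using t by (simp add: s_def)
    let ?m = "\<lambda>u. khinchin_mean f (exp u)"
    define s' where "s' = s + 2 / ?m s"
    have m_pos: "?m u > 0" if "ereal (exp u) < ?R" for u
      using that by (intro khinchin_mean_pos) auto
    have "?m s > 0" using t s by (intro m_pos) auto
    have exp_s': "t * exp (2 / khinchin_mean f t) = exp s'"
      using s by (simp add: s'_def exp_add)
    have ss': "s < s'" using \<open>?m s > 0\<close> by (simp add: s'_def)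
    have slow: "1 / ?m s \<le> 1 / ?m u + 1/4 * (u - s)" if "s < u" "ereal (exp u) < ?R" for u
    proof (rule inverse_mean_lower_bound[OF that])
      fix v assume "s < v" "ereal (exp v) < ?R"
      moreover have "exp s < exp v" using \<open>s < v\<close> by simp
      ultimately show "(?q (exp v))\<^sup>2 \<le> 1/4" using t s by (intro q) auto
    qed
    have R: "ereal (exp s') < ?R"
    proof (cases ?R)
      case (real r)
      then have r: "0 < r" "t < r" using t class_K_conv_radius_pos by auto
      define \<rho> where "\<rho> = ln r"
      have \<rho>: "exp \<rho> = r" using r by (simp add: \<rho>_def)
      have "exp s < exp \<rho>" using s r \<rho> by simp
      then have s\<rho>: "s < \<rho>" by simp
      \<comment> \<open>Let \<open>1 / m\<close> fall from \<open>s\<close> towards the endpoint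
        \<open>\<rho>\<close>: it comes arbitrarily close to \<open>0\<close> before
        \<open>\<rho>\<close>, yet falls at rate at most \<open>1/4\<close>. The slack
        \<open>e\<close> stands for its remaining value.\<close>
      have "1 / ?m s \<le> 1/4 * (\<rho> - s)"
      proof (rule field_le_epsilon)
        fix e :: real assume e: "e > 0"
        define L where "L = ln (eval_fps f t)"
        \<comment> \<open>At this level \<open>ln f\<close> has risen by more than
          \<open>(\<rho> - s) / e\<close> over an interval shorter than \<open>\<rho> - s\<close>,
          so its slope \<open>?m z\<close> exceeds \<open>1 / e\<close> somewhere.\<close>
        obtain t' where t': "t < t'" "ereal t' < ?R" "exp (L + (\<rho> - s) / e) < eval_fps f t'"
          using clan_unbounded[OF clan t(3)] by blast
        define v where "v = ln t'"
        have v: "exp v = t'" using t' t by (simp add: v_def)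
        have "exp s < exp v" "exp v < exp \<rho>" using s v t' real \<rho> by auto
        then have v': "s < v" "v < \<rho>" by auto
        obtain z where z: "s < z" "z < v" "ereal (exp z) < ?R"
          "ln (eval_fps f (exp v)) - ln (eval_fps f (exp s)) = (v - s) * ?m z"
          using ln_class_K_MVT[OF v'(1)] v t'(2) by auto
        have "(\<rho> - s) / e < ln (eval_fps f t') - L"
          using t'(3) ln_less_cancel_iff[of "exp (L + (\<rho> - s) / e)" "eval_fps f t'"]
            less_trans[OF exp_gt_zero t'(3)] by simp
        also have "\<dots> = (v - s) * ?m z" using z(4) v s by (simp add: L_def)
        also have "\<dots> \<le> (\<rho> - s) * ?m z"
          using v' m_pos[OF z(3)] by (intro mult_right_mono) auto
        finally have "(\<rho> - s) * (1 / e) < (\<rho> - s) * ?m z" by simp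
        then have "1 / e < ?m z" using s\<rho> by (simp only: mult_less_cancel_left_pos diff_gt_0_iff_gt)
        then have "1 / ?m z < e"
          using m_pos[OF z(3)] e by (simp add: field_simps)
        moreover have "1 / ?m s \<le> 1 / ?m z + 1/4 * (z - s)" by (rule slow[OF z(1,3)])
        moreover have "1/4 * (z - s) \<le> 1/4 * (\<rho> - s)" using z v' by auto
        ultimately show "1 / ?m s \<le> 1/4 * (\<rho> - s) + e" by linarith
      qed
      \<comment> \<open>The shift \<open>2 / ?m s\<close> is at most
        \<open>(\<rho> - s) / 2\<close>, hence stops short of \<open>\<rho>\<close>.\<close>
      then have "s' < \<rho>" using s\<rho> by (simp add: s'_def)
      then have "exp s' < exp \<rho>" by simp
      then show ?thesis using real \<rho> by simp
    qed (use class_K_conv_radius_pos in auto)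
    then show "ereal (t * exp (2 / khinchin_mean f t)) < ?R" by (simp add: exp_s')
    obtain z where z: "s < z" "z < s'" "ereal (exp z) < ?R"
      "ln (eval_fps f (exp s')) - ln (eval_fps f (exp s)) = (s' - s) * ?m z"
      using ln_class_K_MVT[OF ss' R] by blast
    have "1 / ?m s \<le> 1 / ?m z + 1/4 * (s' - s)"
      using slow[OF z(1,3)] z(2) by (elim order_trans) simp
    \<comment> \<open>Here \<open>1/4 * (s' - s)\<close> equals \<open>1 / (2 * ?m s)\<close>, half
      of the left-hand side.\<close>
    then have "1 / (2 * ?m s) \<le> 1 / ?m z" by (simp add: s'_def field_simps)
    then have "?m z \<le> 2 * ?m s"
      using \<open>?m s > 0\<close> m_pos[OF z(3)] by (simp add: field_simps)
    then have "(s' - s) * ?m z \<le> (s' - s) * (2 * ?m s)"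
      using ss' by (intro mult_left_mono) auto
    also have "\<dots> = 4" using \<open>?m s > 0\<close> by (simp add: s'_def)
    finally have "ln (eval_fps f (exp s')) - ln (eval_fps f t) \<le> 4"
      using z(4) s by simp
    moreover have pos: "eval_fps f (exp s') > 0" "eval_fps f t > 0"
      using eval_class_K_pos R t by auto
    ultimately have "ln (eval_fps f (exp s') / eval_fps f t) \<le> 4"
      by (simp add: ln_div)
    then have "exp (ln (eval_fps f (exp s') / eval_fps f t)) \<le> exp 4"
      by simp
    then show "eval_fps f (t * exp (2 / khinchin_mean f t)) / eval_fps f t \<le> exp 4"
      using pos by (simp add: exp_s')
  qed (use t0 in auto)
qed

section \<open>Comparison of the moments and the limit\<close>

text \<open>Integrates \<open>abs_powr_minus_one_le\<close> at \<open>y = X / m\<close>: the term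
  \<open>exp (2 * y)\<close> is the exponential moment with \<open>c = 2 / m\<close>, and
  \<open>(y - 1)\<^sup>2\<close> integrates to the dispersion.\<close>

lemma khinchin_powr_moment_deviation:
  assumes t: "0 < t" "ereal t < fps_conv_radius f"
      "ereal (t * exp (2 / khinchin_mean f t)) < fps_conv_radius f"
    and p: "0 < p" "p \<le> real k" and \<delta>: "\<delta> > 0"
  shows "\<bar>measure_pmf.expectation (khinchin_pmf f t) (\<lambda>n. real n powr p) / khinchin_mean f t powr p - 1\<bar>
    \<le> fact k * (\<delta> * (eval_fps f (t * exp (2 / khinchin_mean f t)) / eval_fps f t)
        + (khinchin_sd f t / khinchin_mean f t)\<^sup>2 / \<delta>)"
proof -
  let ?P = "measure_pmf (khinchin_pmf f t)"
  define m where "m = khinchin_mean f t"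
  have m: "m > 0" using khinchin_mean_pos t by (simp add: m_def)
  define Y where "Y n = real n / m" for n :: nat
  define g where "g n = fact k * (\<delta> * exp (2 / m * real n) + (real n - m)\<^sup>2 / m\<^sup>2 / \<delta>)" for n :: nat
  have bound: "\<bar>Y n powr p - 1\<bar> \<le> g n" for n
  proof -
    have "(Y n - 1)\<^sup>2 = (real n - m)\<^sup>2 / m\<^sup>2"
      using m by (simp add: Y_def field_simps power2_eq_square)
    then show ?thesis
      using abs_powr_minus_one_le[of "Y n" p k \<delta>] m p \<delta> by (simp add: Y_def g_def)
  qed
  have int_exp: "integrable ?P (\<lambda>n. exp (2 / m * real n))"
    unfolding m_def using t by (intro khinchin_exp_moment) auto
  have int_dev: "integrable ?P (\<lambda>n. (real n - m)\<^sup>2)"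
    using t by (intro integrable_khinchin_deviation) auto
  have int_g: "integrable ?P g"
    unfolding g_def using int_exp int_dev by simp
  \<comment> \<open>For real \<open>p\<close> integrability comes from domination by
    \<open>g\<close>.\<close>
  have int_diff: "integrable ?P (\<lambda>n. Y n powr p - 1)"
    by (rule Bochner_Integration.integrable_bound[OF int_g])
       (use bound in \<open>auto intro: order_trans[OF _ abs_ge_self]\<close>)
  then have int_Y: "integrable ?P (\<lambda>n. Y n powr p)"
    using Bochner_Integration.integrable_add[OF int_diff, of "\<lambda>_. 1"] by simp
  have "(\<integral>n. real n powr p \<partial>?P) / m powr p - 1 = (\<integral>n. Y n powr p \<partial>?P) - 1"
    by (simp add: Y_def powr_divide)
  also have "\<dots> = (\<integral>n. (Y n powr p - 1) \<partial>?P)"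
    using int_Y by simp
  also have "\<bar>\<dots>\<bar> \<le> (\<integral>n. \<bar>Y n powr p - 1\<bar> \<partial>?P)"
    by (rule integral_abs_bound)
  also have "\<dots> \<le> (\<integral>n. g n \<partial>?P)"
    using int_diff int_g bound by (intro integral_mono) auto
  also have "\<dots> = fact k * (\<delta> * (\<integral>n. exp (2 / m * real n) \<partial>?P) + (\<integral>n. (real n - m)\<^sup>2 \<partial>?P) / m\<^sup>2 / \<delta>)"
    unfolding g_def using int_exp int_dev by simp
  also have "(\<integral>n. exp (2 / m * real n) \<partial>?P) = eval_fps f (t * exp (2 / m)) / eval_fps f t"
    unfolding m_def using t by (intro khinchin_exp_moment) auto
  also have "(\<integral>n. (real n - m)\<^sup>2 \<partial>?P) / m\<^sup>2 = (khinchin_sd f t / m)\<^sup>2"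
    by (simp add: m_def khinchin_sd_square power_divide)
  finally show ?thesis by (simp add: m_def)
qed

end

theorem theorem4p18:
  fixes f :: "real fps"
  assumes "f \<in> class_K" and "clan f"
  shows "\<forall>p::real. p > 0 \<longrightarrow>
    ((\<lambda>t. measure_pmf.expectation (khinchin_pmf f t) (\<lambda>n. real n powr p)
           / khinchin_mean f t powr p) \<longlongrightarrow> 1) (at_up (fps_conv_radius f))"
proof (intro allI impI tendstoI)
  fix p e :: real assume p: "p > 0" and e: "e > 0"
  let ?R = "fps_conv_radius f"
  let ?q = "\<lambda>t. khinchin_sd f t / khinchin_mean f t"
  obtain k where k: "p \<le> real k" using real_arch_simple by blast
  define C where "C = (fact k :: real)"
  have C: "C > 0" by (simp add: C_def)
  \<comment> \<open>Splits \<open>e\<close> into halves: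
    \<open>C * \<delta> * exp 4 = e / 2\<close>, and the bound \<open>e * \<delta> / (2 * C)\<close>
    imposed below on the dispersion makes the other term less than \<open>e / 2\<close>.\<close>
  define \<delta> where "\<delta> = e / (2 * C * exp 4)"
  have \<delta>: "\<delta> > 0" using C e by (simp add: \<delta>_def)
  have "((\<lambda>t. (?q t)\<^sup>2) \<longlongrightarrow> 0\<^sup>2) (at_up ?R)"
    using assms(2) unfolding clan_def by (intro tendsto_power)
  then have "eventually (\<lambda>t. (?q t)\<^sup>2 < e * \<delta> / (2 * C)) (at_up ?R)"
    using C e \<delta> by (intro order_tendstoD(2)[where y = "0\<^sup>2"]) auto
  moreover have "eventually (\<lambda>t. 0 < t \<and> ereal t < ?R) (at_up ?R)"
    unfolding eventually_at_up[OF class_K_conv_radius_pos[OF assms(1)]]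
    using ereal_dense2[OF class_K_conv_radius_pos[OF assms(1)]]
    by (auto simp: zero_ereal_def)
  ultimately show "eventually (\<lambda>t. dist (measure_pmf.expectation (khinchin_pmf f t) (\<lambda>n. real n powr p)
      / khinchin_mean f t powr p) 1 < e) (at_up ?R)"
    using clan_exp_shift[OF assms]
  proof eventually_elim
    case (elim t)
    let ?E = "eval_fps f (t * exp (2 / khinchin_mean f t)) / eval_fps f t"
    have "\<bar>measure_pmf.expectation (khinchin_pmf f t) (\<lambda>n. real n powr p) / khinchin_mean f t powr p - 1\<bar>
        \<le> C * (\<delta> * ?E + (?q t)\<^sup>2 / \<delta>)"
      unfolding C_def using elim p k \<delta>
      by (intro khinchin_powr_moment_deviation[OF assms(1)]) auto
    also have "\<dots> < C * (\<delta> * exp 4 + (e * \<delta> / (2 * C)) / \<delta>)"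
      using elim C \<delta> by (intro mult_strict_left_mono add_le_less_mono mult_left_mono divide_strict_right_mono) auto
    also have "\<dots> = e"
      using C \<delta> by (simp add: \<delta>_def field_simps)
    finally show ?case by (simp add: dist_real_def)
  qed
qed

end
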